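(* Let $\alpha,\beta\in(0,\infty]$ and let $a:=\alpha^{-1}$, $b:=\beta^{-1}$ (with $\infty^{-1}=0$). Let $n\ge1$ (with $n\ge2$ if $\alpha=\beta=\infty$), let $S_n(j):=S_{n,\alpha,\beta}(n+1-j,j)$ be the symbol in the diagonal box in column $j$ of the random $\alpha/\beta$-staircase tableau $S_{n,\alpha,\beta}$, and let $1\le j_1<\dots<j_\ell\le n$. Then $$\mathbb P\bigl(S_n(j_1)=\dots=S_n(j_\ell)=\alpha\bigr)=\prod_{k=1}^{\ell}\frac{j_k-k+b}{n-k+a+b}.$$
   Context: An $\alpha/\beta$-staircase tableau of size $n\ge1$ is a filling of the Young diagram of shape $(n,n-1,\dots,2,1)$, whose boxes are $(i,j)$ (row $i$ from the top, column $j$ from the left) with $i,j\ge1$, $i+j\le n+1$, such that: each box is empty or contains one of the symbols $\alpha,\beta$; no diagonal box (box with $i+j=n+1$) is empty; all boxes in the same row and to the left of a $\beta$ are empty; all boxes in the same column and above an $\alpha$ are empty. Let $\bar{\mathcal S}_n$ be the set of these tableaux. For $S\in\bar{\mathcal S}_n$ let $N_\alpha(S),N_\beta(S)$ be the numbers of symbols $\alpha$ and $\beta$ in $S$, and let $S(i,j)$ be the symbol in box $(i,j)$. (The letters $\alpha,\beta$ are used both as symbols in the tableaux and as parameter values; in the event $S_n(j_1)=\dots=S_n(j_\ell)=\alpha$, $\alpha$ is the symbol.) For parameter values $\alpha,\beta\in(0,\infty)$, $S_{n,\alpha,\beta}$ is the random element of $\bar{\mathcal S}_n$ with $\mathbb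 P(S_{n,\alpha,\beta}=S)=\alpha^{N_\alpha(S)}\beta^{N_\beta(S)}/Z_n(\alpha,\beta)$, where $Z_n(\alpha,\beta)=\sum_{S\in\bar{\mathcal S}_n}\alpha^{N_\alpha(S)}\beta^{N_\beta(S)}$. If exactly one of $\alpha,\beta$ is $\infty$, the distribution is the limit of this one as that parameter tends to $\infty$ with the other fixed; if $\alpha=\beta=\infty$, it is the limit as $\alpha=\beta\to\infty$. *)

theory Defs
  imports "HOL-Probability.Probability"
begin

datatype symb = Sym_alpha | Sym_beta

type_synonym filling = "nat \<times> nat \<Rightarrow> symb option"

definition boxes :: "nat \<Rightarrow> (nat \<times> nat) set" where
  "boxes n = {(i, j). 1 \<le> i \<and> 1 \<le> j \<and> i + j \<le> n + 1}"

(* A filling is a total function; requiring it to be None outside the diagram makes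
   tableaux of size n correspond one-to-one to these functions. *)
definition staircase_tableaux :: "nat \<Rightarrow> filling set" where
  "staircase_tableaux n = {S.
     (\<forall>p. p \<notin> boxes n \<longrightarrow> S p = None) \<and>
     (\<forall>i j. (i, j) \<in> boxes n \<and> i + j = n + 1 \<longrightarrow> S (i, j) \<noteq> None) \<and>
     (\<forall>i j j'. S (i, j) = Some Sym_beta \<and> j' < j \<longrightarrow> S (i, j') = None) \<and>
     (\<forall>i i' j. S (i, j) = Some Sym_alpha \<and> i' < i \<longrightarrow> S (i', j) = None)}"

definition num_symb :: "symb \<Rightarrow> filling \<Rightarrow> nat" where
  "num_symb s S = card {p. S p = Some s}"

definition weight :: "real \<Rightarrow> real \<Rightarrow> filling \<Rightarrow> real" where
  "weight \<alpha> \<beta> S = \<alpha> ^ num_symb Sym_alpha S * \<beta> ^ num_symb Sym_beta S"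

definition Z :: "nat \<Rightarrow> real \<Rightarrow> real \<Rightarrow> real" where
  "Z n \<alpha> \<beta> = (\<Sum>S\<in>staircase_tableaux n. weight \<alpha> \<beta> S)"

definition finite_mass :: "nat \<Rightarrow> real \<Rightarrow> real \<Rightarrow> filling \<Rightarrow> real" where
  "finite_mass n \<alpha> \<beta> S =
     (if S \<in> staircase_tableaux n then weight \<alpha> \<beta> S / Z n \<alpha> \<beta> else 0)"

(* Only positive parameters are meaningful; the value for minus infinity is arbitrary. *)
definition tableau_mass :: "nat \<Rightarrow> ereal \<Rightarrow> ereal \<Rightarrow> filling \<Rightarrow> real" where
  "tableau_mass n \<alpha> \<beta> S =
     (if \<alpha> = \<infinity> \<and> \<beta> = \<infinity> then Lim at_top (\<lambda>x. finite_mass n x x S)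
      else if \<alpha> = \<infinity> then Lim at_top (\<lambda>x. finite_mass n x (real_of_ereal \<beta>) S)
      else if \<beta> = \<infinity> then Lim at_top (\<lambda>y. finite_mass n (real_of_ereal \<alpha>) y S)
      else finite_mass n (real_of_ereal \<alpha>) (real_of_ereal \<beta>) S)"

definition random_tableau :: "nat \<Rightarrow> ereal \<Rightarrow> ereal \<Rightarrow> filling pmf" where
  "random_tableau n \<alpha> \<beta> = embed_pmf (tableau_mass n \<alpha> \<beta>)"

definition diag_symb :: "nat \<Rightarrow> filling \<Rightarrow> nat \<Rightarrow> symb option" where
  "diag_symb n S j = S (n + 1 - j, j)"


text \<open>The limits and the probability mass functions used above exist for all positive
  parameters, so that neither \<open>Lim\<close> nor \<open>embed_pmf\<close> returns an unspecified value.\<close>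

lemma finite_boxes: "finite (boxes n)"
  by (rule finite_subset[of _ "{..n+1} \<times> {..n+1}"]) (auto simp: boxes_def)

lemma finite_staircase_tableaux: "finite (staircase_tableaux n)"
proof (rule finite_subset)
  show "staircase_tableaux n \<subseteq>
     {S. \<forall>p. (p \<in> boxes n \<longrightarrow> S p \<in> {None, Some Sym_alpha, Some Sym_beta}) \<and> (p \<notin> boxes n \<longrightarrow> S p = None)}"
    proof (intro subsetI CollectI allI conjI impI)
    fix S p assume S: "S \<in> staircase_tableaux n"
    show "S p \<in> {None, Some Sym_alpha, Some Sym_beta}"
      by (cases "S p"; cases "the (S p)") auto
    show "S p = None" if "p \<notin> boxes n"
      using S that unfolding staircase_tableaux_def by blast
  qed
  show "finite \<dots>"
    by (rule finite_set_of_finite_funs) (auto simp: finite_boxes)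
qed

lemma staircase_tableaux_nonempty: "staircase_tableaux n \<noteq> {}"
proof -
  have "(\<lambda>(i, j). if (i, j) \<in> boxes n \<and> i + j = n + 1 then Some Sym_alpha else None)
          \<in> staircase_tableaux n"
    by (auto simp: staircase_tableaux_def)
  then show ?thesis by blast
qed

lemma Z_pos: "0 < x \<Longrightarrow> 0 < y \<Longrightarrow> 0 < Z n x y"
  unfolding Z_def weight_def
  by (intro sum_pos finite_staircase_tableaux staircase_tableaux_nonempty) auto

lemma finite_mass_nonneg: "0 < x \<Longrightarrow> 0 < y \<Longrightarrow> 0 \<le> finite_mass n x y S"
  using Z_pos[of x y n] by (simp add: finite_mass_def weight_def)

lemma sum_finite_mass:
  "0 < x \<Longrightarrow> 0 < y \<Longrightarrow> (\<Sum>S\<in>staircase_tableaux n. finite_mass n x y S) = 1"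
  using Z_pos[of x y n]
  by (simp add: finite_mass_def flip: sum_divide_distrib Z_def)

lemma convergent_ratio:
  fixes g :: "'a \<Rightarrow> real" and p :: "'a \<Rightarrow> nat"
  assumes "finite T" "S \<in> T" and g: "\<And>S. S \<in> T \<Longrightarrow> 0 < g S"
  shows "\<exists>L. ((\<lambda>x. x ^ p S * g S / (\<Sum>U\<in>T. x ^ p U * g U)) \<longlongrightarrow> L) at_top"
proof -
  define m where "m = Max (p ` T)"
  have le: "p U \<le> m" if "U \<in> T" for U
    using that assms by (simp add: m_def)
  have "m \<in> p ` T"
    unfolding m_def using assms by (intro Max_in) auto
  then obtain M where M: "M \<in> T" "p M = m" by blast
  define c where "c U = (if p U = m then g U else 0)" for U
  have lim: "((\<lambda>x. x ^ p U * g U / x ^ m) \<longlongrightarrow> c U) at_top" if "U \<in> T" for U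
  proof (cases "p U = m")
    case True
    have "\<forall>\<^sub>F x in at_top. c U = x ^ p U * g U / x ^ m"
      using eventually_gt_at_top[of 0] by eventually_elim (simp add: True c_def)
    then show ?thesis by (rule Lim_transform_eventually[OF tendsto_const])
  next
    case False
    then have lt: "p U < m" using le[OF that] by simp
    have "((\<lambda>x::real. g U * inverse (x ^ (m - p U))) \<longlongrightarrow> g U * 0) at_top"
      using lt by (intro tendsto_mult tendsto_const tendsto_inverse_0_at_top filterlim_pow_at_top
          filterlim_ident) auto
    moreover have "\<forall>\<^sub>F x in at_top. g U * inverse (x ^ (m - p U)) = x ^ p U * g U / x ^ m"
      using eventually_gt_at_top[of 0]
      by eventually_elim (use lt in \<open>simp add: power_diff field_simps\<close>)
    ultimately show ?thesis
      using False by (auto simp: c_def intro: Lim_transform_eventually)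
  qed
  have "c M \<le> sum c T"
    using M assms by (intro member_le_sum) (auto simp: c_def intro: less_imp_le)
  then have "sum c T \<noteq> 0" using M g[of M] by (simp add: c_def)
  then have "((\<lambda>x. (x ^ p S * g S / x ^ m) / (\<Sum>U\<in>T. x ^ p U * g U / x ^ m))
      \<longlongrightarrow> c S / sum c T) at_top"
    by (intro tendsto_divide tendsto_sum lim assms)
  moreover have "\<forall>\<^sub>F x in at_top. (x ^ p S * g S / x ^ m) / (\<Sum>U\<in>T. x ^ p U * g U / x ^ m)
      = x ^ p S * g S / (\<Sum>U\<in>T. x ^ p U * g U)"
    using eventually_gt_at_top[of 0]
    by eventually_elim (simp flip: sum_divide_distrib)
  ultimately show ?thesis by (blast intro: Lim_transform_eventually)
qed

lemma tendsto_Lim_at_top: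
  fixes f :: "real \<Rightarrow> real"
  shows "\<exists>L. (f \<longlongrightarrow> L) at_top \<Longrightarrow> (f \<longlongrightarrow> Lim at_top f) at_top"
  using tendsto_Lim[of at_top f] by auto

lemma finite_mass_convergent:
  fixes f g :: "real \<Rightarrow> real"
  assumes w: "\<And>x U. weight (f x) (g x) U = x ^ p U * c U" and c: "\<And>U. 0 < c U"
  shows "\<exists>L. ((\<lambda>x. finite_mass n (f x) (g x) S) \<longlongrightarrow> L) at_top"
proof (cases "S \<in> staircase_tableaux n")
  case True
  then show ?thesis
    using convergent_ratio[OF finite_staircase_tableaux True, of c p] c
    by (simp add: finite_mass_def Z_def w)
next
  case False
  then show ?thesis by (auto simp: finite_mass_def)
qed

lemma tableau_mass_limit_alpha:
  assumes "0 < y"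
  shows "((\<lambda>x. finite_mass n x y S) \<longlongrightarrow> tableau_mass n \<infinity> (ereal y) S) at_top"
  using tendsto_Lim_at_top[OF finite_mass_convergent[of "\<lambda>x. x" "\<lambda>x. y" "num_symb Sym_alpha"
      "\<lambda>S. y ^ num_symb Sym_beta S" n S]] assms
  by (simp add: tableau_mass_def weight_def)

lemma tableau_mass_limit_beta:
  assumes "0 < x"
  shows "((\<lambda>y. finite_mass n x y S) \<longlongrightarrow> tableau_mass n (ereal x) \<infinity> S) at_top"
  using tendsto_Lim_at_top[OF finite_mass_convergent[of "\<lambda>y. x" "\<lambda>y. y" "num_symb Sym_beta"
      "\<lambda>S. x ^ num_symb Sym_alpha S" n S]] assms
  by (simp add: tableau_mass_def weight_def)

lemma tableau_mass_limit_both: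
  "((\<lambda>x. finite_mass n x x S) \<longlongrightarrow> tableau_mass n \<infinity> \<infinity> S) at_top"
  using tendsto_Lim_at_top[OF finite_mass_convergent[of "\<lambda>x. x" "\<lambda>x. x"
      "\<lambda>S. num_symb Sym_alpha S + num_symb Sym_beta S" "\<lambda>S. 1" n S]]
  by (simp add: tableau_mass_def weight_def power_add)

lemma tableau_mass_finite [simp]:
  "tableau_mass n (ereal x) (ereal y) S = finite_mass n x y S"
  by (simp add: tableau_mass_def)

lemma mass_limit:
  assumes lim: "\<And>S. ((\<lambda>x::real. finite_mass n (f x) (g x) S) \<longlongrightarrow> h S) at_top"
    and pos: "\<And>x. 0 < x \<Longrightarrow> 0 < f x \<and> 0 < g x"
  shows "0 \<le> h S" and "(\<Sum>S\<in>staircase_tableaux n. h S) = 1"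
    and "S \<notin> staircase_tableaux n \<Longrightarrow> h S = 0"
proof -
  show "0 \<le> h S"
  proof (rule tendsto_lowerbound[OF lim])
    show "\<forall>\<^sub>F x in at_top. 0 \<le> finite_mass n (f x) (g x) S"
      using eventually_gt_at_top[of 0] by eventually_elim (use pos finite_mass_nonneg in blast)
  qed simp
  have "((\<lambda>x. \<Sum>S\<in>staircase_tableaux n. finite_mass n (f x) (g x) S)
      \<longlongrightarrow> (\<Sum>S\<in>staircase_tableaux n. h S)) at_top"
    by (intro tendsto_sum lim)
  moreover have "\<forall>\<^sub>F x in at_top. (\<Sum>S\<in>staircase_tableaux n. finite_mass n (f x) (g x) S) = 1"
    using eventually_gt_at_top[of 0] by eventually_elim (use pos sum_finite_mass in blast)
  then have "((\<lambda>x. \<Sum>S\<in>staircase_tableaux n. finite_mass n (f x) (g x) S) \<longlongrightarrow> 1) at_top"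
    by (rule tendsto_eventually)
  ultimately show "(\<Sum>S\<in>staircase_tableaux n. h S) = 1"
    by (rule tendsto_unique[rotated]) simp
  show "h S = 0" if "S \<notin> staircase_tableaux n"
    using lim[of S] that by (simp add: finite_mass_def tendsto_const_iff)
qed

lemma tableau_mass_pmf:
  assumes "0 < \<alpha>" "0 < \<beta>"
  shows "0 \<le> tableau_mass n \<alpha> \<beta> S \<and> (\<Sum>S\<in>staircase_tableaux n. tableau_mass n \<alpha> \<beta> S) = 1
    \<and> (S \<notin> staircase_tableaux n \<longrightarrow> tableau_mass n \<alpha> \<beta> S = 0)"
proof (cases \<alpha>; cases \<beta>)
  fix x y assume "\<alpha> = ereal x" "\<beta> = ereal y"
  then show ?thesis
    using assms by (simp add: finite_mass_nonneg sum_finite_mass) (simp add: finite_mass_def)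
next
  fix x assume "\<alpha> = ereal x" "\<beta> = \<infinity>"
  then show ?thesis
    using assms mass_limit[OF tableau_mass_limit_beta[of x n]] by simp
next
  fix y assume "\<alpha> = \<infinity>" "\<beta> = ereal y"
  then show ?thesis
    using assms mass_limit[OF tableau_mass_limit_alpha[of y n]] by simp
next
  assume "\<alpha> = \<infinity>" "\<beta> = \<infinity>"
  then show ?thesis
    using mass_limit[OF tableau_mass_limit_both[of n]] by simp
qed (use assms in auto)

lemma pmf_random_tableau:
  assumes "0 < \<alpha>" "0 < \<beta>"
  shows "pmf (random_tableau n \<alpha> \<beta>) S = tableau_mass n \<alpha> \<beta> S"
  unfolding random_tableau_def
proof (rule pmf_embed_pmf)
  note m = tableau_mass_pmf[OF assms, of n]
  show "0 \<le> tableau_mass n \<alpha> \<beta> S" for S using m by blast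
  have "(\<integral>\<^sup>+S. ennreal (tableau_mass n \<alpha> \<beta> S) \<partial>count_space UNIV)
      = (\<Sum>S\<in>staircase_tableaux n. ennreal (tableau_mass n \<alpha> \<beta> S))"
    using m by (intro nn_integral_count_space' finite_staircase_tableaux) auto
  also have "\<dots> = ennreal (\<Sum>S\<in>staircase_tableaux n. tableau_mass n \<alpha> \<beta> S)"
    using m by (intro sum_ennreal) auto
  also have "\<dots> = 1" using m by simp
  finally show "(\<integral>\<^sup>+S. ennreal (tableau_mass n \<alpha> \<beta> S) \<partial>count_space UNIV) = 1" .
qed

end

theory Submission
  imports Defs
begin

text \<open>
  The tableaux of size \<open>n + 1\<close> arise from those of size \<open>n\<close> by attaching a new column on the
  left (\<open>bij_betw_attach\<close>). A row admits a symbol in the new column iff it contains no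
  \<open>\<beta>\<close>; call such rows free. The only information about the old tableau that matters is
  therefore its number \<open>r\<close> of free rows, and one studies the generating function \<open>F\<^sub>n(x)\<close>
  of weight times \<open>x\<^sup>r\<close>, restricted to the tableaux having \<open>\<alpha>\<close> in the prescribed diagonal
  boxes.

  Summing over all possible new columns, whose bottom box is the new diagonal box, replaces
  \<open>x\<^sup>r\<close> by \<open>\<alpha>x \<cdot> x\<^sup>r\<close> when the bottom symbol is required to be \<open>\<alpha>\<close> (all other
  boxes of the column are then empty), and by \<open>(\<beta> + \<alpha>x)(x + \<beta>)\<^sup>r\<close> when the bottom symbol is
  arbitrary (\<open>column_sum_closed_form\<close>). So an \<open>\<alpha>\<close>-column multiplies the generating function
  by \<open>\<alpha>x\<close>, and a column without prescription multiplies it by \<open>\<beta> + \<alpha>x\<close> and shifts the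
  argument of the remaining factor by \<open>\<beta>\<close> (\<open>free_row_gf_Suc\<close>). In terms of \<open>s = x/\<beta>\<close> these
  are, up to the common factor \<open>\<alpha>\<beta>\<close>, multiplication by \<open>s\<close>, and multiplication by
  \<open>s + a\<close> followed by \<open>s \<mapsto> s + 1\<close>.

  Reading the columns from left to right, the factor of the prescribed column \<open>j\<^sub>k\<close> is thus
  \<open>s\<close> plus the number \<open>j\<^sub>k - k\<close> of unprescribed columns before it, while the unprescribed
  columns contribute \<open>s + a, s + a + 1, \<dots>\<close>, \<open>n - l\<close> factors in all
  (\<open>free_row_gf_closed_form\<close>). At \<open>x = 1\<close>, that is \<open>s = b\<close>, dividing by the same product with
  no prescription, which is the partition function, leaves the claimed
  product for finite parameters (\<open>finite_mass_diag_alpha\<close>). Infinite parameters follow by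
  letting each factor tend to its limit.
\<close>

section \<open>Weighted fillings of a single column\<close>

text \<open>The fillings of a column whose nonempty boxes lie in the rows \<open>R\<close>. Only the rule for
  \<open>\<alpha>\<close> constrains a column by itself; the rule for \<open>\<beta>\<close> enters through the choice of \<open>R\<close>.\<close>

definition column_fillings :: "nat set \<Rightarrow> (nat \<Rightarrow> symb option) set" where
  "column_fillings R = {c. (\<forall>i. i \<notin> R \<longrightarrow> c i = None) \<and>
     (\<forall>i i'. c i = Some Sym_alpha \<and> i' < i \<longrightarrow> c i' = None)}"

text \<open>The variable \<open>x\<close> marks the rows of \<open>R\<close> that are still free of \<open>\<beta>\<close> after the column
  has been placed.\<close>

definition column_weight :: "real \<Rightarrow> real \<Rightarrow> real \<Rightarrow> nat set \<Rightarrow> (nat \<Rightarrow> symb option) \<Rightarrow> real" where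
  "column_weight \<alpha> \<beta> x R c = \<alpha> ^ card {i. c i = Some Sym_alpha} * \<beta> ^ card {i. c i = Some Sym_beta}
     * x ^ card {i \<in> R. c i \<noteq> Some Sym_beta}"

definition column_sum :: "real \<Rightarrow> real \<Rightarrow> real \<Rightarrow> nat set \<Rightarrow> real" where
  "column_sum \<alpha> \<beta> x R = (\<Sum>c\<in>column_fillings R. column_weight \<alpha> \<beta> x R c)"

lemma symb_option_cases: "s = None \<or> s = Some Sym_alpha \<or> s = Some Sym_beta"
  by (cases s; cases "the s") auto

lemma finite_column_fillings:
  assumes "finite R"
  shows "finite (column_fillings R)"
proof (rule finite_subset)
  show "column_fillings R \<subseteq> {c. \<forall>i. (i \<in> R \<longrightarrow> c i \<in> {None, Some Sym_alpha, Some Sym_beta})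
      \<and> (i \<notin> R \<longrightarrow> c i = None)}"
    using symb_option_cases by (auto simp: column_fillings_def)
  show "finite \<dots>"
    by (rule finite_set_of_finite_funs) (auto simp: assms)
qed

text \<open>An \<open>\<alpha>\<close> in the lowest row forces all the other boxes to be empty, whereas a \<open>\<beta>\<close> or an
  empty box there imposes nothing on the rest of the column.\<close>

lemma column_fillings_bottom:
  assumes "\<forall>i\<in>R. i < m"
  shows column_fillings_bottom_alpha:
      "{c \<in> column_fillings (insert m R). c m = Some Sym_alpha} = {(\<lambda>_. None)(m := Some Sym_alpha)}"
    and column_fillings_bottom_beta:
      "{c \<in> column_fillings (insert m R). c m = Some Sym_beta}
        = (\<lambda>c. c(m := Some Sym_beta)) ` column_fillings R"
    and column_fillings_bottom_None:
      "{c \<in> column_fillings (insert m R). c m = None} = column_fillings R"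
proof -
  show "{c \<in> column_fillings (insert m R). c m = Some Sym_alpha} = {(\<lambda>_. None)(m := Some Sym_alpha)}"
    using assms by (fastforce simp: column_fillings_def fun_eq_iff split: if_splits)
  show "{c \<in> column_fillings (insert m R). c m = Some Sym_beta}
        = (\<lambda>c. c(m := Some Sym_beta)) ` column_fillings R" (is "?L = ?R")
  proof
    show "?L \<subseteq> ?R"
    proof
      fix c assume "c \<in> ?L"
      then have "c(m := None) \<in> column_fillings R" "c = (c(m := None))(m := Some Sym_beta)"
        using assms by (auto simp: column_fillings_def)
      then show "c \<in> ?R" by blast
    qed
    show "?R \<subseteq> ?L"
    proof
      fix c' assume "c' \<in> ?R"
      then obtain c where c: "c \<in> column_fillings R" "c' = c(m := Some Sym_beta)" by blast
      have "i < m" if "c i = Some Sym_alpha" for i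
        using that c assms by (force simp: column_fillings_def)
      then show "c' \<in> ?L"
        using c by (fastforce simp: column_fillings_def)
    qed
  qed
  show "{c \<in> column_fillings (insert m R). c m = None} = column_fillings R"
    using assms by (auto simp: column_fillings_def) metis
qed

lemma column_sum_bottom:
  assumes fin: "finite R" and less: "\<forall>i\<in>R. i < m"
  shows column_sum_bottom_alpha:
      "(\<Sum>c | c \<in> column_fillings (insert m R) \<and> c m = Some Sym_alpha.
          column_weight \<alpha> \<beta> x (insert m R) c) = \<alpha> * x * x ^ card R"
    and column_sum_bottom_beta:
      "(\<Sum>c | c \<in> column_fillings (insert m R) \<and> c m = Some Sym_beta.
          column_weight \<alpha> \<beta> x (insert m R) c) = \<beta> * column_sum \<alpha> \<beta> x R"
    and column_sum_bottom_None:
      "(\<Sum>c | c \<in> column_fillings (insert m R) \<and> c m = None.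
          column_weight \<alpha> \<beta> x (insert m R) c) = x * column_sum \<alpha> \<beta> x R"
proof -
  have m: "m \<notin> R" using less by blast
  have "{i. ((\<lambda>_. None)(m := Some Sym_alpha)) i = Some s} = (if s = Sym_alpha then {m} else {})" for s
    by (cases s) auto
  moreover have "{i \<in> insert m R. ((\<lambda>_. None)(m := Some Sym_alpha)) i \<noteq> Some Sym_beta} = insert m R"
    by auto
  ultimately show "(\<Sum>c | c \<in> column_fillings (insert m R) \<and> c m = Some Sym_alpha.
          column_weight \<alpha> \<beta> x (insert m R) c) = \<alpha> * x * x ^ card R"
    unfolding column_fillings_bottom_alpha[OF less] using fin m by (simp add: column_weight_def)
  have None: "c m = None" if "c \<in> column_fillings R" for c
    using that m by (simp add: column_fillings_def)
  have finc: "finite {i. c i = Some s}" if "c \<in> column_fillings R" for c s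
    by (rule finite_subset[OF _ fin]) (use that in \<open>auto simp: column_fillings_def\<close>)
  have inj: "inj_on (\<lambda>c. c(m := Some Sym_beta)) (column_fillings R)"
    by (rule inj_on_inverseI[of _ "\<lambda>c. c(m := None)"]) (use None in \<open>simp add: fun_upd_idem\<close>)
  have "column_weight \<alpha> \<beta> x (insert m R) (c(m := Some Sym_beta)) = \<beta> * column_weight \<alpha> \<beta> x R c"
    if c: "c \<in> column_fillings R" for c
  proof -
    have "{i. (c(m := Some Sym_beta)) i = Some Sym_alpha} = {i. c i = Some Sym_alpha}"
      "{i. (c(m := Some Sym_beta)) i = Some Sym_beta} = insert m {i. c i = Some Sym_beta}"
      "{i \<in> insert m R. (c(m := Some Sym_beta)) i \<noteq> Some Sym_beta} = {i \<in> R. c i \<noteq> Some Sym_beta}"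
      using None[OF c] m by auto
    then show ?thesis
      using finc[OF c] None[OF c] by (simp add: column_weight_def)
  qed
  then show "(\<Sum>c | c \<in> column_fillings (insert m R) \<and> c m = Some Sym_beta.
          column_weight \<alpha> \<beta> x (insert m R) c) = \<beta> * column_sum \<alpha> \<beta> x R"
    unfolding column_fillings_bottom_beta[OF less] sum.reindex[OF inj] column_sum_def sum_distrib_left
    by (intro sum.cong) auto
  have "column_weight \<alpha> \<beta> x (insert m R) c = x * column_weight \<alpha> \<beta> x R c"
    if c: "c \<in> column_fillings R" for c
  proof -
    have "{i \<in> insert m R. c i \<noteq> Some Sym_beta} = insert m {i \<in> R. c i \<noteq> Some Sym_beta}"
      using None[OF c] by auto
    then show ?thesis
      using fin m by (simp add: column_weight_def)
  qed
  then show "(\<Sum>c | c \<in> column_fillings (insert m R) \<and> c m = None.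
          column_weight \<alpha> \<beta> x (insert m R) c) = x * column_sum \<alpha> \<beta> x R"
    unfolding column_fillings_bottom_None[OF less] column_sum_def sum_distrib_left
    by (intro sum.cong) auto
qed

lemma column_sum_empty: "column_sum \<alpha> \<beta> x {} = 1"
proof -
  have "column_fillings {} = {\<lambda>_. None}"
    by (auto simp: column_fillings_def)
  then show ?thesis by (simp add: column_sum_def column_weight_def)
qed

lemma column_sum_insert:
  assumes fin: "finite R" and less: "\<forall>i\<in>R. i < m"
  shows "column_sum \<alpha> \<beta> x (insert m R) = \<alpha> * x * x ^ card R + (x + \<beta>) * column_sum \<alpha> \<beta> x R"
proof -
  let ?C = "column_fillings (insert m R)" and ?w = "column_weight \<alpha> \<beta> x (insert m R)"
  have "?C = {c \<in> ?C. c m = Some Sym_alpha} \<union> ({c \<in> ?C. c m = Some Sym_beta} \<union> {c \<in> ?C. c m = None})"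
    (is "_ = ?A \<union> (?B \<union> ?N)")
    using symb_option_cases by blast
  then have "sum ?w ?C = sum ?w (?A \<union> (?B \<union> ?N))" by (rule arg_cong)
  also have "\<dots> = sum ?w ?A + sum ?w (?B \<union> ?N)"
    using finite_column_fillings[of "insert m R"] fin by (intro sum.union_disjoint) auto
  also have "sum ?w (?B \<union> ?N) = sum ?w ?B + sum ?w ?N"
    using finite_column_fillings[of "insert m R"] fin by (intro sum.union_disjoint) auto
  finally show ?thesis
    unfolding column_sum_bottom[OF assms] by (simp add: column_sum_def algebra_simps)
qed

text \<open>The left-hand side is the total weight of a new column with \<open>card R\<close> admissible rows above
  a nonempty bottom box: the first summand has \<open>\<alpha>\<close> in the bottom box, the second \<open>\<beta>\<close>.
  The column sum alone would satisfy only an inhomogeneous recursion in \<open>card R\<close>; for this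
  combination the recursion becomes multiplication by \<open>x + \<beta>\<close>, which gives the product.\<close>

lemma column_sum_closed_form:
  assumes "finite R"
  shows "\<alpha> * x * x ^ card R + \<beta> * column_sum \<alpha> \<beta> x R = (\<beta> + \<alpha> * x) * (x + \<beta>) ^ card R"
  using assms
proof (induction R rule: finite_linorder_max_induct)
  case empty
  show ?case by (simp add: column_sum_empty)
next
  case (insert m R)
  then have "card (insert m R) = Suc (card R)" by auto
  then have "\<alpha> * x * x ^ card (insert m R) + \<beta> * column_sum \<alpha> \<beta> x (insert m R)
      = (x + \<beta>) * (\<alpha> * x * x ^ card R + \<beta> * column_sum \<alpha> \<beta> x R)"
    using insert.hyps by (simp add: column_sum_insert algebra_simps)
  then show ?case
    using insert by auto
qed

section \<open>Attaching a column to a tableau\<close>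

definition free_rows :: "nat \<Rightarrow> filling \<Rightarrow> nat set" where
  "free_rows n S = {i \<in> {1..n}. \<forall>j. S (i, j) \<noteq> Some Sym_beta}"

text \<open>Columns are numbered from 1, so the index 0 is padded with empty boxes.\<close>

definition attach :: "(nat \<Rightarrow> symb option) \<Rightarrow> filling \<Rightarrow> filling" where
  "attach c S = (\<lambda>(i, j). if j = 0 then None else if j = 1 then c i else S (i, j - 1))"

definition alpha_tableaux :: "nat \<Rightarrow> nat set \<Rightarrow> filling set" where
  "alpha_tableaux n J = {S \<in> staircase_tableaux n. \<forall>j\<in>J. diag_symb n S j = Some Sym_alpha}"

definition free_row_gf :: "nat \<Rightarrow> real \<Rightarrow> real \<Rightarrow> nat set \<Rightarrow> real \<Rightarrow> real" where
  "free_row_gf n \<alpha> \<beta> J x = (\<Sum>S\<in>alpha_tableaux n J. weight \<alpha> \<beta> S * x ^ card (free_rows n S))"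

lemma attach_simps [simp]:
  "attach c S (i, 0) = None" "attach c S (i, Suc 0) = c i"
  "0 < j \<Longrightarrow> attach c S (i, Suc j) = S (i, j)"
  by (simp_all add: attach_def)

lemma finite_free_rows: "finite (free_rows n S)"
  by (simp add: free_rows_def)

lemma staircase_tableauxD:
  assumes "S \<in> staircase_tableaux n"
  shows staircase_tableaux_outside: "p \<notin> boxes n \<Longrightarrow> S p = None"
    and staircase_tableaux_diagonal: "(i, j) \<in> boxes n \<Longrightarrow> i + j = n + 1 \<Longrightarrow> S (i, j) \<noteq> None"
    and staircase_tableaux_beta: "S (i, j) = Some Sym_beta \<Longrightarrow> j' < j \<Longrightarrow> S (i, j') = None"
    and staircase_tableaux_alpha: "S (i, j) = Some Sym_alpha \<Longrightarrow> i' < i \<Longrightarrow> S (i', j) = None"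
proof -
  note S = assms[unfolded staircase_tableaux_def mem_Collect_eq]
  show "p \<notin> boxes n \<Longrightarrow> S p = None" using S by blast
  show "(i, j) \<in> boxes n \<Longrightarrow> i + j = n + 1 \<Longrightarrow> S (i, j) \<noteq> None" using S by blast
  show "S (i, j) = Some Sym_beta \<Longrightarrow> j' < j \<Longrightarrow> S (i, j') = None" using S by blast
  show "S (i, j) = Some Sym_alpha \<Longrightarrow> i' < i \<Longrightarrow> S (i', j) = None" using S by blast
qed

text \<open>The new column lies to the left of every row, so the rule for \<open>\<beta>\<close> allows it a symbol exactly
  in the free rows and in the new bottom row; the old diagonal is again on the diagonal, one column
  further right.\<close>

lemma attach_in_staircase_tableaux_iff:
  assumes S0: "\<And>i. S (i, 0) = None"
  shows "attach c S \<in> staircase_tableaux (Suc n) \<longleftrightarrow>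
    S \<in> staircase_tableaux n \<and> c \<in> column_fillings (insert (Suc n) (free_rows n S)) \<and> c (Suc n) \<noteq> None"
    (is "?L \<longleftrightarrow> ?R")
proof
  assume L: ?L
  note out = staircase_tableaux_outside[OF L] and diag = staircase_tableaux_diagonal[OF L]
    and beta = staircase_tableaux_beta[OF L] and alpha = staircase_tableaux_alpha[OF L]
  have pos: "0 < j" if "S (i, j) = Some s" for i j s
    using that S0[of i] by (cases j) auto
  have "S \<in> staircase_tableaux n"
    unfolding staircase_tableaux_def mem_Collect_eq
  proof (intro conjI allI impI; (elim conjE)?)
    fix p assume "p \<notin> boxes n"
    then show "S p = None"
      using out[of "(fst p, Suc (snd p))"] S0[of "fst p"]
      by (cases p; cases "snd p") (auto simp: boxes_def)
  next
    fix i j assume "(i, j) \<in> boxes n" "i + j = n + 1"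
    then show "S (i, j) \<noteq> None"
      using diag[of i "Suc j"] by (auto simp: boxes_def)
  next
    fix i j j' assume *: "S (i, j) = Some Sym_beta" "j' < j"
    then show "S (i, j') = None"
      using beta[of i "Suc j" "Suc j'"] pos S0[of i] by (cases j') auto
  next
    fix i i' j assume *: "S (i, j) = Some Sym_alpha" "i' < i"
    then show "S (i', j) = None"
      using alpha[of i "Suc j" "i'"] pos by auto
  qed
  moreover have "c i = None" if i: "i \<notin> insert (Suc n) (free_rows n S)" for i
  proof (cases "i \<in> {1..n}")
    case True
    then obtain j where j: "S (i, j) = Some Sym_beta"
      using i by (auto simp: free_rows_def)
    then show ?thesis
      using beta[of i "Suc j" "Suc 0"] pos by auto
  next
    case False
    then show ?thesis
      using i out[of "(i, Suc 0)"] by (auto simp: boxes_def)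
  qed
  moreover have "c i' = None" if "c i = Some Sym_alpha" "i' < i" for i i'
    using alpha[of i "Suc 0" i'] that by simp
  moreover have "c (Suc n) \<noteq> None"
    using diag[of "Suc n" 1] by (auto simp: boxes_def)
  ultimately show ?R by (auto simp: column_fillings_def)
next
  assume R: ?R
  then have S: "S \<in> staircase_tableaux n" and bottom: "c (Suc n) \<noteq> None"
    and c: "c \<in> column_fillings (insert (Suc n) (free_rows n S))"
    by simp_all
  note out = staircase_tableaux_outside[OF S] and diag = staircase_tableaux_diagonal[OF S]
    and beta = staircase_tableaux_beta[OF S] and alpha = staircase_tableaux_alpha[OF S]
  have c_out: "c i = None" if "i \<noteq> Suc n" "i \<notin> free_rows n S" for i
    using c that unfolding column_fillings_def by blast
  have c_alpha: "c i' = None" if "c i = Some Sym_alpha" "i' < i" for i i'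
    using c that unfolding column_fillings_def by blast
  have c_beta: "c i = None" if "S (i, j) = Some Sym_beta" for i j
  proof (rule c_out)
    show "i \<noteq> Suc n" using that out[of "(i, j)"] by (auto simp: boxes_def)
    show "i \<notin> free_rows n S" using that by (auto simp: free_rows_def)
  qed
  show ?L
    unfolding staircase_tableaux_def mem_Collect_eq
  proof (intro conjI allI impI; (elim conjE)?)
    fix p assume p: "p \<notin> boxes (Suc n)"
    obtain i j where [simp]: "p = (i, j)" by fastforce
    show "attach c S p = None"
    proof (cases "j \<le> 1")
      case True
      then show ?thesis
        using p c_out[of i] by (cases j) (auto simp: boxes_def free_rows_def)
    next
      case False
      then obtain k where "j = Suc k" "0 < k" by (cases j) auto
      then show ?thesis
        using p out[of "(i, k)"] by (auto simp: boxes_def)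
    qed
  next
    fix i j assume *: "(i, j) \<in> boxes (Suc n)" "i + j = Suc n + 1"
    show "attach c S (i, j) \<noteq> None"
    proof (cases "j = 1")
      case True
      then show ?thesis using * bottom by simp
    next
      case False
      then obtain k where "j = Suc k" "0 < k" using * by (cases j) (auto simp: boxes_def)
      then show ?thesis
        using * diag[of i k] by (auto simp: boxes_def)
    qed
  next
    fix i j j' assume *: "attach c S (i, j) = Some Sym_beta" "j' < j"
    show "attach c S (i, j') = None"
    proof (cases "j' = 0")
      case False
      then obtain k k' where k: "j = Suc k" "j' = Suc k'" "0 < k" "k' < k"
        using * by (cases j; cases j') auto
      then have "S (i, k) = Some Sym_beta" using * by simp
      then show ?thesis
        using k beta[of i k k'] c_beta[of i k] by (cases "k' = 0") auto
    qed simp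
  next
    fix i i' j assume *: "attach c S (i, j) = Some Sym_alpha" "i' < i"
    then show "attach c S (i', j) = None"
      using alpha c_alpha by (auto simp: attach_def split: if_splits)
  qed
qed

lemma diag_symb_attach:
  "diag_symb (Suc n) (attach c S) (Suc 0) = c (Suc n)"
  "0 < j \<Longrightarrow> diag_symb (Suc n) (attach c S) (Suc j) = diag_symb n S j"
  by (simp_all add: diag_symb_def)

text \<open>Every tableau of size \<open>n + 1\<close> is obtained exactly once, by splitting off its first column.
  A prescription \<open>J\<close> on the diagonal splits into the one for column 1, which constrains the
  bottom box of the new column, and the others, which move down by one.\<close>

lemma bij_betw_attach:
  assumes "J \<subseteq> {1..Suc n}"
  shows "bij_betw (\<lambda>(S, c). attach c S)
    (SIGMA S:alpha_tableaux n {j. Suc j \<in> J \<and> 0 < j}.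
       {c \<in> column_fillings (insert (Suc n) (free_rows n S)).
          if 1 \<in> J then c (Suc n) = Some Sym_alpha else c (Suc n) \<noteq> None})
    (alpha_tableaux (Suc n) J)" (is "bij_betw _ ?A ?B")
proof (rule bij_betw_byWitness[where
      f' = "\<lambda>T. (\<lambda>(i, j). if j = 0 then None else T (i, Suc j), \<lambda>i. T (i, 1))"])
  have S0: "S (i, 0) = None" if "S \<in> staircase_tableaux n" for S n i
    using staircase_tableaux_outside[OF that, of "(i, 0)"] by (simp add: boxes_def)
  have diag: "(\<forall>j\<in>J. diag_symb (Suc n) (attach c S) j = Some Sym_alpha) \<longleftrightarrow>
      (1 \<in> J \<longrightarrow> c (Suc n) = Some Sym_alpha) \<and>
      (\<forall>j\<in>{j. Suc j \<in> J \<and> 0 < j}. diag_symb n S j = Some Sym_alpha)" (is "?l \<longleftrightarrow> ?r") for c S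
  proof
    assume ?l
    then show ?r by (fastforce simp: diag_symb_attach dest: bspec)
  next
    assume r: ?r
    show ?l
    proof
      fix j assume j: "j \<in> J"
      then obtain k where "j = Suc k" using assms by (cases j) auto
      then show "diag_symb (Suc n) (attach c S) j = Some Sym_alpha"
        using r j by (cases k) (auto simp: diag_symb_attach)
    qed
  qed
  have attach_iff: "attach c S \<in> ?B \<longleftrightarrow> (S, c) \<in> ?A" if "\<And>i. S (i, 0) = None" for c S
    unfolding alpha_tableaux_def mem_Collect_eq mem_Sigma_iff diag
      attach_in_staircase_tableaux_iff[of S, OF that]
    by auto
  show "(\<lambda>(S, c). attach c S) ` ?A \<subseteq> ?B"
  proof
    fix T assume "T \<in> (\<lambda>(S, c). attach c S) ` ?A"
    then obtain S c where p: "(S, c) \<in> ?A" and T: "T = attach c S" by auto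
    then have "S \<in> staircase_tableaux n" by (simp add: alpha_tableaux_def)
    then show "T \<in> ?B" using attach_iff[of S c] S0 p unfolding T by blast
  qed
  show "\<forall>p\<in>?A. (\<lambda>T. (\<lambda>(i, j). if j = 0 then None else T (i, Suc j), \<lambda>i. T (i, 1)))
      ((\<lambda>(S, c). attach c S) p) = p"
    by (auto simp: alpha_tableaux_def fun_eq_iff) (metis S0)+
  have inv: "attach (\<lambda>i. T (i, 1)) (\<lambda>(i, j). if j = 0 then None else T (i, Suc j)) = T"
    if "T \<in> ?B" for T
  proof
    fix p :: "nat \<times> nat"
    obtain i j where p: "p = (i, j)" by fastforce
    have "T (i, 0) = None" using that S0[of T "Suc n" i] by (simp add: alpha_tableaux_def)
    then show "attach (\<lambda>i. T (i, 1)) (\<lambda>(i, j). if j = 0 then None else T (i, Suc j)) p = T p"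
      unfolding p by (simp add: attach_def)
  qed
  then show "\<forall>T\<in>?B. (\<lambda>(S, c). attach c S)
      (\<lambda>(i, j). if j = 0 then None else T (i, Suc j), \<lambda>i. T (i, 1)) = T"
    by simp
  show "(\<lambda>T. (\<lambda>(i, j). if j = 0 then None else T (i, Suc j), \<lambda>i. T (i, 1))) ` ?B \<subseteq> ?A"
  proof
    fix q assume "q \<in> (\<lambda>T. (\<lambda>(i, j). if j = 0 then None else T (i, Suc j), \<lambda>i. T (i, 1))) ` ?B"
    then obtain T where T: "T \<in> ?B"
      and q: "q = (\<lambda>(i, j). if j = 0 then None else T (i, Suc j), \<lambda>i. T (i, 1))" by blast
    show "q \<in> ?A"
      unfolding q using T inv[OF T] by (subst attach_iff[symmetric]) simp_all
  qed
qed

lemma weight_attach: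
  assumes S: "S \<in> staircase_tableaux n" and c: "c \<in> column_fillings R" and R: "finite R"
  shows "weight \<alpha> \<beta> (attach c S) = weight \<alpha> \<beta> S *
    (\<alpha> ^ card {i. c i = Some Sym_alpha} * \<beta> ^ card {i. c i = Some Sym_beta})"
proof -
  have "num_symb s (attach c S) = num_symb s S + card {i. c i = Some s}" for s
  proof -
    have S0: "0 < j" if "S (i, j) = Some s" for i j
      using that staircase_tableaux_outside[OF S, of "(i, 0)"] by (cases j) (auto simp: boxes_def)
    have "{p. attach c S p = Some s}
        = (\<lambda>(i, j). (i, Suc j)) ` {p. S p = Some s} \<union> (\<lambda>i. (i, Suc 0)) ` {i. c i = Some s}"
      (is "_ = ?f ` ?P \<union> ?g ` ?Q")
    proof
      show "{p. attach c S p = Some s} \<subseteq> ?f ` ?P \<union> ?g ` ?Q"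
      proof
        fix p assume "p \<in> {p. attach c S p = Some s}"
        then have p: "attach c S (fst p, snd p) = Some s" by simp
        then consider "snd p = Suc 0" "c (fst p) = Some s"
          | k where "snd p = Suc k" "S (fst p, k) = Some s"
          by (cases "snd p") (auto simp: attach_def split: if_splits)
        then show "p \<in> ?f ` ?P \<union> ?g ` ?Q"
          by cases (force intro: rev_image_eqI simp: prod_eq_iff)+
      qed
      show "?f ` ?P \<union> ?g ` ?Q \<subseteq> {p. attach c S p = Some s}"
        using S0 by auto
    qed
    moreover have "finite ?P"
      by (rule finite_subset[OF _ finite_boxes[of n]]) (use staircase_tableaux_outside[OF S] in fastforce)
    moreover have "finite ?Q"
      by (rule finite_subset[OF _ R]) (use c in \<open>auto simp: column_fillings_def\<close>)
    moreover have "?f ` ?P \<inter> ?g ` ?Q = {}"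
      using S0 by fastforce
    ultimately show ?thesis
      by (simp add: num_symb_def card_Un_disjoint card_image inj_on_def split_beta prod_eq_iff)
  qed
  then show ?thesis
    by (simp add: weight_def power_add)
qed

lemma free_rows_attach:
  assumes S: "S \<in> staircase_tableaux n"
  shows "free_rows (Suc n) (attach c S) = {i \<in> insert (Suc n) (free_rows n S). c i \<noteq> Some Sym_beta}"
proof -
  have S0: "0 < j" if "S (i, j) = Some s" for i j s
    using that staircase_tableaux_outside[OF S, of "(i, 0)"] by (cases j) (auto simp: boxes_def)
  have "(\<exists>j. attach c S (i, j) = Some Sym_beta) \<longleftrightarrow>
      c i = Some Sym_beta \<or> (\<exists>j. S (i, j) = Some Sym_beta)" (is "?l \<longleftrightarrow> ?r") for i
  proof
    assume ?r
    then show ?l using S0 by (metis attach_simps(2,3))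
  qed (auto simp: attach_def split: if_splits)
  then have "(\<forall>j. attach c S (i, j) \<noteq> Some Sym_beta) \<longleftrightarrow>
      c i \<noteq> Some Sym_beta \<and> (\<forall>j. S (i, j) \<noteq> Some Sym_beta)" for i
    by blast
  moreover have "S (Suc n, j) = None" for j
    using staircase_tableaux_outside[OF S] by (auto simp: boxes_def)
  ultimately show ?thesis
    unfolding free_rows_def by (auto simp: le_Suc_eq)
qed

section \<open>The generating function of the number of free rows\<close>

text \<open>The sum over the old tableau and the new column factorises, since the new weight and the
  new number of free rows depend on the old tableau only through its weight and its free rows.\<close>

lemma free_row_gf_Suc:
  assumes J: "J \<subseteq> {1..Suc n}"
  defines "J' \<equiv> {j. Suc j \<in> J \<and> 0 < j}"
  shows "free_row_gf (Suc n) \<alpha> \<beta> J x =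
    (if 1 \<in> J then \<alpha> * x * free_row_gf n \<alpha> \<beta> J' x else (\<beta> + \<alpha> * x) * free_row_gf n \<alpha> \<beta> J' (x + \<beta>))"
proof -
  define R where "R S = insert (Suc n) (free_rows n S)" for S
  define C where "C S = {c \<in> column_fillings (R S).
      if 1 \<in> J then c (Suc n) = Some Sym_alpha else c (Suc n) \<noteq> None}" for S
  have finR: "finite (R S)" for S
    by (simp add: R_def finite_free_rows)
  have finA: "finite (alpha_tableaux n J')"
    unfolding alpha_tableaux_def by (simp add: finite_staircase_tableaux)
  have "free_row_gf (Suc n) \<alpha> \<beta> J x = (\<Sum>(S, c)\<in>(SIGMA S:alpha_tableaux n J'. C S).
      weight \<alpha> \<beta> (attach c S) * x ^ card (free_rows (Suc n) (attach c S)))"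
    unfolding free_row_gf_def C_def R_def J'_def
    by (subst sum.reindex_bij_betw[OF bij_betw_attach[OF J], symmetric]) (simp add: split_beta)
  also have "\<dots> = (\<Sum>S\<in>alpha_tableaux n J'. \<Sum>c\<in>C S.
      weight \<alpha> \<beta> (attach c S) * x ^ card (free_rows (Suc n) (attach c S)))"
    by (subst sum.Sigma[symmetric]) (auto simp: finA C_def finite_column_fillings finR)
  also have "\<dots> = (\<Sum>S\<in>alpha_tableaux n J'. weight \<alpha> \<beta> S * (\<Sum>c\<in>C S. column_weight \<alpha> \<beta> x (R S) c))"
    unfolding sum_distrib_left
  proof (intro sum.cong refl)
    fix S c assume "S \<in> alpha_tableaux n J'" "c \<in> C S"
    then have S: "S \<in> staircase_tableaux n" and c: "c \<in> column_fillings (R S)"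
      by (auto simp: alpha_tableaux_def C_def)
    show "weight \<alpha> \<beta> (attach c S) * x ^ card (free_rows (Suc n) (attach c S))
        = weight \<alpha> \<beta> S * column_weight \<alpha> \<beta> x (R S) c"
      by (simp add: weight_attach[OF S c finR] free_rows_attach[OF S] column_weight_def R_def)
  qed
  also have "\<dots> = (\<Sum>S\<in>alpha_tableaux n J'. weight \<alpha> \<beta> S *
      (if 1 \<in> J then \<alpha> * x * x ^ card (free_rows n S)
       else (\<beta> + \<alpha> * x) * (x + \<beta>) ^ card (free_rows n S)))"
  proof (intro sum.cong refl arg_cong2[of _ _ _ _ "(*)"])
    fix S
    have less: "\<forall>i\<in>free_rows n S. i < Suc n" by (auto simp: free_rows_def)
    note sums = column_sum_bottom[OF finite_free_rows less, of \<alpha> \<beta> x, folded R_def]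
    show "(\<Sum>c\<in>C S. column_weight \<alpha> \<beta> x (R S) c) =
      (if 1 \<in> J then \<alpha> * x * x ^ card (free_rows n S)
       else (\<beta> + \<alpha> * x) * (x + \<beta>) ^ card (free_rows n S))"
    proof (cases "1 \<in> J")
      case True
      then show ?thesis using sums(1) by (simp add: C_def)
    next
      case False
      then have "C S = {c \<in> column_fillings (R S). c (Suc n) = Some Sym_alpha} \<union>
          {c \<in> column_fillings (R S). c (Suc n) = Some Sym_beta}" (is "_ = ?A \<union> ?B")
        by (auto simp: C_def) (metis symb.exhaust)
      then have "(\<Sum>c\<in>C S. column_weight \<alpha> \<beta> x (R S) c) = sum (column_weight \<alpha> \<beta> x (R S)) (?A \<union> ?B)"
        by (rule arg_cong)
      also have "\<dots> = sum (column_weight \<alpha> \<beta> x (R S)) ?A + sum (column_weight \<alpha> \<beta> x (R S)) ?B"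
        using finite_column_fillings[OF finR, of S] by (intro sum.union_disjoint) auto
      finally show ?thesis
        using False sums(1,2) column_sum_closed_form[OF finite_free_rows, of \<alpha> x n S \<beta>] by simp
    qed
  qed
  finally show ?thesis
    by (simp add: free_row_gf_def sum_distrib_left mult_ac)
qed

lemma free_row_gf_0: "free_row_gf 0 \<alpha> \<beta> {} x = 1"
proof -
  have "p \<notin> boxes 0" for p by (auto simp: boxes_def)
  then have "staircase_tableaux 0 \<subseteq> {\<lambda>_. None}"
    using staircase_tableaux_outside by fast
  then have "staircase_tableaux 0 = {\<lambda>_. None}"
    using staircase_tableaux_nonempty[of 0] by blast
  then show ?thesis
    by (simp add: free_row_gf_def alpha_tableaux_def weight_def num_symb_def free_rows_def)
qed

text \<open>Iterating the recursion peels off the columns from left to right. The argument has been shifted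
  by \<open>\<beta>\<close> once for each unprescribed column already passed, and \<open>card ({1..<j} - J)\<close> counts these
  when column \<open>j\<close> is reached.\<close>

lemma free_row_gf_closed_form:
  assumes "J \<subseteq> {1..n}"
  shows "free_row_gf n \<alpha> \<beta> J x = (\<Prod>j\<in>J. \<alpha> * (x + \<beta> * real (card ({1..<j} - J))))
    * (\<Prod>i<n - card J. \<beta> + \<alpha> * (x + \<beta> * real i))"
  using assms
proof (induction n arbitrary: J x)
  case 0
  then show ?case by (simp add: free_row_gf_0)
next
  case (Suc n)
  define J' where "J' = {j. Suc j \<in> J \<and> 0 < j}"
  have J': "J' \<subseteq> {1..n}" using Suc.prems by (auto simp: J'_def)
  then have finJ': "finite J'" by (rule finite_subset) simp
  have J_minus: "J - {1} = Suc ` J'"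
  proof
    show "J - {1} \<subseteq> Suc ` J'"
    proof
      fix j assume "j \<in> J - {1}"
      then have "j = Suc (j - 1)" "j - 1 \<in> J'" using Suc.prems by (auto simp: J'_def)
      then show "j \<in> Suc ` J'" by blast
    qed
  qed (auto simp: J'_def)
  have cardJ': "card J' \<le> n" using card_mono[OF _ J'] by simp
  \<comment> \<open>The unprescribed columns before column \<open>j + 1\<close> are those before \<open>j\<close> in the smaller tableau,
    shifted, together with column 1 if it is unprescribed.\<close>
  have gap: "{1..<Suc j} - J = (if 1 \<in> J then {} else {1}) \<union> Suc ` ({1..<j} - J')" if "j \<in> J'" for j
  proof -
    have "{1..<Suc j} = insert 1 (Suc ` {1..<j})"
      using that by (auto simp: J'_def image_iff Suc_le_eq)
    then show ?thesis
      unfolding \<open>{1..<Suc j} = _\<close> by (auto simp: J'_def simp del: image_Suc_atLeastLessThan)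
  qed
  note rec = free_row_gf_Suc[OF Suc.prems, of \<alpha> \<beta> x, folded J'_def]
  show ?case
  proof (cases "1 \<in> J")
    case True
    then have J_eq: "J = insert 1 (Suc ` J')" using J_minus by blast
    have notin: "1 \<notin> Suc ` J'" by (auto simp: J'_def)
    have "card J = Suc (card J')"
      unfolding J_eq using finJ' notin by (simp add: card_image)
    then have card: "Suc n - card J = n - card J'" by simp
    have "(\<Prod>j\<in>J. \<alpha> * (x + \<beta> * real (card ({1..<j} - J))))
        = \<alpha> * x * (\<Prod>j\<in>Suc ` J'. \<alpha> * (x + \<beta> * real (card ({1..<j} - J))))"
      unfolding J_eq using finJ' notin by (subst prod.insert) simp_all
    also have "(\<Prod>j\<in>Suc ` J'. \<alpha> * (x + \<beta> * real (card ({1..<j} - J))))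
        = (\<Prod>j\<in>J'. \<alpha> * (x + \<beta> * real (card ({1..<j} - J'))))"
      unfolding prod.reindex[OF inj_on_subset[OF inj_Suc subset_UNIV]] o_def
    proof (intro prod.cong refl)
      fix j assume "j \<in> J'"
      then have "card ({1..<Suc j} - J) = card ({1..<j} - J')"
        using gap[of j] True by (simp add: card_image del: image_Suc_atLeastLessThan)
      then show "\<alpha> * (x + \<beta> * real (card ({1..<Suc j} - J))) = \<alpha> * (x + \<beta> * real (card ({1..<j} - J')))"
        by (simp only:)
    qed
    finally show ?thesis
      unfolding rec card Suc.IH[OF J'] by (simp only: True if_True mult.assoc)
  next
    case False
    then have J_eq: "J = Suc ` J'" using J_minus by blast
    have "card J = card J'" unfolding J_eq by (simp add: card_image)
    then have card: "Suc n - card J = Suc (n - card J')" using cardJ' by simp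
    have "(\<Prod>j\<in>J. \<alpha> * (x + \<beta> * real (card ({1..<j} - J))))
        = (\<Prod>j\<in>Suc ` J'. \<alpha> * (x + \<beta> * real (card ({1..<j} - J))))"
      by (simp only: J_eq[symmetric])
    also have "\<dots> = (\<Prod>j\<in>J'. \<alpha> * (x + \<beta> + \<beta> * real (card ({1..<j} - J'))))"
      unfolding prod.reindex[OF inj_on_subset[OF inj_Suc subset_UNIV]] o_def
    proof (intro prod.cong refl)
      fix j assume "j \<in> J'"
      then have "{1..<Suc j} - J = insert 1 (Suc ` ({1..<j} - J'))"
        using gap[of j] False by simp
      moreover have "1 \<notin> Suc ` ({1..<j} - J')" by auto
      ultimately have "card ({1..<Suc j} - J) = Suc (card ({1..<j} - J'))"
        by (simp only: card_insert_disjoint finite_imageI finite_Diff finite_atLeastLessThan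
            card_image inj_on_subset[OF inj_Suc subset_UNIV] simp_thms)
      then have "real (card ({1..<Suc j} - J)) = 1 + real (card ({1..<j} - J'))"
        by (simp only: of_nat_Suc)
      then show "\<alpha> * (x + \<beta> * real (card ({1..<Suc j} - J)))
          = \<alpha> * (x + \<beta> + \<beta> * real (card ({1..<j} - J')))"
        by (simp only: distrib_left mult_1_right add.assoc)
    qed
    finally have prods: "(\<Prod>j\<in>J. \<alpha> * (x + \<beta> * real (card ({1..<j} - J)))) = \<dots>" .
    have "(\<Prod>i<Suc (n - card J'). \<beta> + \<alpha> * (x + \<beta> * real i))
        = (\<beta> + \<alpha> * x) * (\<Prod>i<n - card J'. \<beta> + \<alpha> * (x + \<beta> + \<beta> * real i))"
      unfolding prod.lessThan_Suc_shift by (simp add: distrib_left add.assoc)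
    then show ?thesis
      unfolding rec card prods Suc.IH[OF J'] by (simp only: False if_False mult.left_commute)
  qed
qed

section \<open>The distribution of the diagonal\<close>

lemma strict_mono_on_nat_gap:
  fixes j :: "nat \<Rightarrow> nat"
  assumes "strict_mono_on {1..l} j" "1 \<le> k" "k \<le> k'" "k' \<le> l"
  shows "j k + (k' - k) \<le> j k'"
  using assms(3,4)
proof (induction k' rule: dec_induct)
  case (step m)
  then have "j m < j (Suc m)"
    using assms(1,2) by (auto simp: strict_mono_on_def)
  then show ?case using step by simp
qed simp

text \<open>The quotient of the closed forms for the prescription \<open>j ` {1..l}\<close> and for no prescription:
  the \<open>n - l\<close> factors of the unprescribed columns cancel against the first \<open>n - l\<close>
  factors of the partition function.\<close>

lemma finite_mass_diag_alpha:
  fixes j :: "nat \<Rightarrow> nat"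
  assumes pos: "0 < x" "0 < y"
    and mono: "strict_mono_on {1..l} j" and range: "\<forall>k\<in>{1..l}. 1 \<le> j k \<and> j k \<le> n"
  shows "(\<Sum>S\<in>alpha_tableaux n (j ` {1..l}). finite_mass n x y S)
    = (\<Prod>k=1..l. (real (j k) - real k + 1 / y) / (real n - real k + 1 / x + 1 / y))"
proof -
  let ?J = "j ` {1..l}"
  have J: "?J \<subseteq> {1..n}" using range by auto
  have inj: "inj_on j {1..l}" using mono by (rule strict_mono_on_imp_inj_on)
  then have card: "card ?J = l" by (simp add: card_image)
  have ln: "l \<le> n" using card_mono[OF _ J] card by simp
  \<comment> \<open>Of the \<open>j k - 1\<close> columns before \<open>j k\<close>, exactly \<open>k - 1\<close> are prescribed.\<close>
  have gap: "real (card ({1..<j k} - ?J)) = real (j k) - real k" if k: "k \<in> {1..l}" for k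
  proof -
    have less: "j i < j k \<longleftrightarrow> i < k" if "i \<in> {1..l}" for i
      using strict_mono_on_less[OF mono that k] .
    have "{1..<j k} \<inter> ?J = j ` {1..<k}"
      using range less k by auto
    moreover have "card (j ` {1..<k}) = k - 1"
      using inj_on_subset[OF inj, of "{1..<k}"] k by (simp add: card_image subset_eq)
    ultimately have "card ({1..<j k} - ?J) = j k - 1 - (k - 1)"
      by (metis card_Diff_subset_Int card_atLeastLessThan finite_Int finite_atLeastLessThan)
    moreover have "k \<le> j k"
      using strict_mono_on_nat_gap[OF mono, of 1 k] k range by force
    ultimately show ?thesis using k by auto
  qed
  have "(\<Sum>S\<in>alpha_tableaux n ?J. finite_mass n x y S) = free_row_gf n x y ?J 1 / Z n x y"
    by (simp add: free_row_gf_def sum_divide_distrib finite_mass_def alpha_tableaux_def)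
  also have "Z n x y = free_row_gf n x y {} 1"
    by (simp add: Z_def free_row_gf_def alpha_tableaux_def)
  also have "free_row_gf n x y ?J 1 = (\<Prod>k=1..l. x * (1 + y * (real (j k) - real k)))
      * (\<Prod>i<n - l. y + x * (1 + y * real i))"
  proof -
    have "(\<Prod>i\<in>?J. x * (1 + y * real (card ({1..<i} - ?J))))
        = (\<Prod>k=1..l. x * (1 + y * (real (j k) - real k)))"
      unfolding prod.reindex[OF inj] o_def by (intro prod.cong refl) (simp only: gap)
    then show ?thesis by (simp only: free_row_gf_closed_form[OF J] card)
  qed
  also have "free_row_gf n x y {} 1 = (\<Prod>k=1..l. y + x * (1 + y * (real n - real k)))
      * (\<Prod>i<n - l. y + x * (1 + y * real i))"
  proof -
    have "(\<Prod>i<n. y + x * (1 + y * real i)) = (\<Prod>i\<in>{..<n - l} \<union> {n - l..<n}. y + x * (1 + y * real i))"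
      by (intro prod.cong) auto
    also have "\<dots> = (\<Prod>i<n - l. y + x * (1 + y * real i)) * (\<Prod>i=n - l..<n. y + x * (1 + y * real i))"
      by (subst prod.union_disjoint) auto
    also have "(\<Prod>i=n - l..<n. y + x * (1 + y * real i)) = (\<Prod>k=1..l. y + x * (1 + y * (real n - real k)))"
      by (rule prod.reindex_bij_witness[of _ "\<lambda>k. n - k" "\<lambda>i. n - i"]) (use ln in \<open>auto simp: of_nat_diff\<close>)
    finally show ?thesis by (simp add: free_row_gf_closed_form mult.commute)
  qed
  also have "(\<Prod>k=1..l. x * (1 + y * (real (j k) - real k))) * (\<Prod>i<n - l. y + x * (1 + y * real i)) /
      ((\<Prod>k=1..l. y + x * (1 + y * (real n - real k))) * (\<Prod>i<n - l. y + x * (1 + y * real i)))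
      = (\<Prod>k=1..l. x * (1 + y * (real (j k) - real k))) / (\<Prod>k=1..l. y + x * (1 + y * (real n - real k)))"
  proof -
    have "0 < y + x * (1 + y * real i)" for i
      using pos by (intro add_pos_nonneg) auto
    then have "(\<Prod>i<n - l. y + x * (1 + y * real i)) \<noteq> 0"
      by (metis prod_pos less_irrefl)
    then show ?thesis by simp
  qed
  also have "\<dots> = (\<Prod>k=1..l. (real (j k) - real k + 1 / y) / (real n - real k + 1 / x + 1 / y))"
    unfolding prod_dividef[symmetric]
  proof (intro prod.cong refl)
    fix k
    have "x * (1 + y * (real (j k) - real k)) = (x * y) * (real (j k) - real k + 1 / y)"
      and "y + x * (1 + y * (real n - real k)) = (x * y) * (real n - real k + 1 / x + 1 / y)"
      using pos by (simp_all add: field_simps)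
    then show "x * (1 + y * (real (j k) - real k)) / (y + x * (1 + y * (real n - real k)))
        = (real (j k) - real k + 1 / y) / (real n - real k + 1 / x + 1 / y)"
      using pos by simp
  qed
  finally show ?thesis .
qed

text \<open>Stated for arbitrary paths \<open>f\<close>, \<open>g\<close> of the two parameters, so that it covers one parameter
  tending to infinity as well as both jointly.\<close>

lemma mass_limit_diag_alpha:
  fixes j :: "nat \<Rightarrow> nat" and f g :: "real \<Rightarrow> real"
  assumes lim: "\<And>S. ((\<lambda>x. finite_mass n (f x) (g x) S) \<longlongrightarrow> h S) at_top"
    and pos: "\<And>x. 0 < x \<Longrightarrow> 0 < f x \<and> 0 < g x"
    and mono: "strict_mono_on {1..l} j" and range: "\<forall>k\<in>{1..l}. 1 \<le> j k \<and> j k \<le> n"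
    and factor: "\<And>k. k \<in> {1..l} \<Longrightarrow>
      ((\<lambda>x. (real (j k) - real k + 1 / g x) / (real n - real k + 1 / f x + 1 / g x)) \<longlongrightarrow> q k) at_top"
  shows "(\<Sum>S\<in>alpha_tableaux n (j ` {1..l}). h S) = (\<Prod>k=1..l. q k)"
proof (rule tendsto_unique)
  show "((\<lambda>x. \<Sum>S\<in>alpha_tableaux n (j ` {1..l}). finite_mass n (f x) (g x) S)
      \<longlongrightarrow> (\<Sum>S\<in>alpha_tableaux n (j ` {1..l}). h S)) at_top"
    by (intro tendsto_sum lim)
  have "((\<lambda>x. \<Prod>k=1..l. (real (j k) - real k + 1 / g x) / (real n - real k + 1 / f x + 1 / g x))
      \<longlongrightarrow> (\<Prod>k=1..l. q k)) at_top"
    by (intro tendsto_prod factor)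
  moreover have "\<forall>\<^sub>F x in at_top.
      (\<Prod>k=1..l. (real (j k) - real k + 1 / g x) / (real n - real k + 1 / f x + 1 / g x))
      = (\<Sum>S\<in>alpha_tableaux n (j ` {1..l}). finite_mass n (f x) (g x) S)"
    using eventually_gt_at_top[of 0]
    by eventually_elim (use pos finite_mass_diag_alpha[OF _ _ mono range] in simp)
  ultimately show "((\<lambda>x. \<Sum>S\<in>alpha_tableaux n (j ` {1..l}). finite_mass n (f x) (g x) S)
      \<longlongrightarrow> (\<Prod>k=1..l. q k)) at_top"
    by (rule Lim_transform_eventually)
qed simp

lemma prob_random_tableau:
  assumes "0 < \<alpha>" "0 < \<beta>"
  shows "measure_pmf.prob (random_tableau n \<alpha> \<beta>) {S. \<forall>j\<in>J. diag_symb n S j = Some Sym_alpha}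
    = (\<Sum>S\<in>alpha_tableaux n J. tableau_mass n \<alpha> \<beta> S)"
proof -
  have sub: "set_pmf (random_tableau n \<alpha> \<beta>) \<subseteq> staircase_tableaux n"
  proof
    fix S assume "S \<in> set_pmf (random_tableau n \<alpha> \<beta>)"
    then have "tableau_mass n \<alpha> \<beta> S \<noteq> 0"
      by (simp add: set_pmf_iff pmf_random_tableau[OF assms])
    then show "S \<in> staircase_tableaux n"
      using tableau_mass_pmf[OF assms, of n S] by blast
  qed
  have "measure_pmf.prob (random_tableau n \<alpha> \<beta>) {S. \<forall>j\<in>J. diag_symb n S j = Some Sym_alpha}
      = measure_pmf.prob (random_tableau n \<alpha> \<beta>) (alpha_tableaux n J)"
    using sub by (intro measure_pmf.finite_measure_eq_AE) (auto simp: AE_measure_pmf_iff alpha_tableaux_def)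
  also have "\<dots> = (\<Sum>S\<in>alpha_tableaux n J. pmf (random_tableau n \<alpha> \<beta>) S)"
    by (intro measure_measure_pmf_finite) (simp add: alpha_tableaux_def finite_staircase_tableaux)
  finally show ?thesis by (simp add: pmf_random_tableau[OF assms])
qed

theorem theorem7p6:
  fixes \<alpha> \<beta> :: ereal and a b :: real and n l :: nat and j :: "nat \<Rightarrow> nat"
  assumes "0 < \<alpha>" and "0 < \<beta>"
    and "a = real_of_ereal (inverse \<alpha>)" and "b = real_of_ereal (inverse \<beta>)"
    and "1 \<le> n" and "\<alpha> = \<infinity> \<and> \<beta> = \<infinity> \<longrightarrow> 2 \<le> n"
    and "1 \<le> l"
    and "strict_mono_on {1..l} j" and "\<forall>k\<in>{1..l}. 1 \<le> j k \<and> j k \<le> n"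
  shows "measure_pmf.prob (random_tableau n \<alpha> \<beta>)
           {S. \<forall>k\<in>{1..l}. diag_symb n S (j k) = Some Sym_alpha}
         = (\<Prod>k=1..l. (real (j k) - real k + b) / (real n - real k + a + b))"
proof -
  note mono = assms(8) and range = assms(9)
  have gap: "j k + (k' - k) \<le> j k'" if "1 \<le> k" "k \<le> k'" "k' \<le> l" for k k'
    using strict_mono_on_nat_gap[OF mono that] .
  have j_bounds: "k \<le> j k" "j k \<le> n" if "k \<in> {1..l}" for k
  proof -
    have "1 \<in> {1..l}" using that by auto
    then have "1 \<le> j 1" using range by blast
    then show "k \<le> j k" using gap[of 1 k] that by auto
    show "j k \<le> n" using range that by blast
  qed
  then have kn: "k \<le> n" if "k \<in> {1..l}" for k
    using that by (meson le_trans)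
  have inverse_lim: "((\<lambda>x::real. 1 / x) \<longlongrightarrow> 0) at_top"
    using tendsto_inverse_0_at_top[OF filterlim_ident] by (simp add: divide_inverse)
  have "(\<Sum>S\<in>alpha_tableaux n (j ` {1..l}). tableau_mass n \<alpha> \<beta> S)
      = (\<Prod>k=1..l. (real (j k) - real k + b) / (real n - real k + a + b))"
  proof (cases \<alpha>; cases \<beta>)
    fix x y assume "\<alpha> = ereal x" "\<beta> = ereal y"
    then show ?thesis
      using assms finite_mass_diag_alpha[OF _ _ mono range, of x y] by (simp add: inverse_eq_divide)
  next
    fix x assume [simp]: "\<alpha> = ereal x" "\<beta> = \<infinity>"
    then have x: "0 < x" "a = 1 / x" "b = 0" using assms by (auto simp: inverse_eq_divide)
    then have "real n - real k + 1 / x + 0 \<noteq> 0" if "k \<in> {1..l}" for k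
      using kn[OF that] by (intro less_imp_neq[symmetric]) (simp add: add_nonneg_pos)
    then have "((\<lambda>y. (real (j k) - real k + 1 / y) / (real n - real k + 1 / x + 1 / y))
        \<longlongrightarrow> (real (j k) - real k + b) / (real n - real k + a + b)) at_top" if "k \<in> {1..l}" for k
      unfolding x using that by (intro tendsto_divide tendsto_add tendsto_const inverse_lim) (use x in auto)
    then show ?thesis
      using mass_limit_diag_alpha[where f = "\<lambda>_. x" and g = "\<lambda>y. y", OF tableau_mass_limit_beta _ mono range] x
      by simp
  next
    fix y assume [simp]: "\<alpha> = \<infinity>" "\<beta> = ereal y"
    then have y: "0 < y" "a = 0" "b = 1 / y" using assms by (auto simp: inverse_eq_divide)
    then have "real n - real k + 0 + 1 / y \<noteq> 0" if "k \<in> {1..l}" for k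
      using kn[OF that] by (intro less_imp_neq[symmetric]) (simp add: add_nonneg_pos)
    then have "((\<lambda>x. (real (j k) - real k + 1 / y) / (real n - real k + 1 / x + 1 / y))
        \<longlongrightarrow> (real (j k) - real k + b) / (real n - real k + a + b)) at_top" if "k \<in> {1..l}" for k
      unfolding y using that by (intro tendsto_divide tendsto_add tendsto_const inverse_lim) (use y in auto)
    then show ?thesis
      using mass_limit_diag_alpha[where f = "\<lambda>x. x" and g = "\<lambda>_. y", OF tableau_mass_limit_alpha _ mono range] y
      by simp
  next
    assume [simp]: "\<alpha> = \<infinity>" "\<beta> = \<infinity>"
    then have ab: "a = 0" "b = 0" and n: "2 \<le> n" using assms by auto
    \<comment> \<open>For \<open>k = n\<close> the factor is constantly \<open>(1/x) / (1/x + 1/x)\<close>, so its limit \<open>1/2\<close> differs from the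
      factor \<open>0 / 0\<close>, which is 0, of the claimed product.\<close>
    define q where "q k = (if k = n then 1 / 2 else (real (j k) - real k) / (real n - real k))" for k
    have "((\<lambda>x. (real (j k) - real k + 1 / x) / (real n - real k + 1 / x + 1 / x)) \<longlongrightarrow> q k) at_top"
      if k: "k \<in> {1..l}" for k
    proof (cases "k = n")
      case True
      have jk: "j n = n" using j_bounds[OF k] True by simp
      have "\<forall>\<^sub>F x in at_top. (real (j k) - real k + 1 / x) / (real n - real k + 1 / x + 1 / x) = q k"
        using eventually_gt_at_top[of "0::real"]
        by eventually_elim (simp add: jk True q_def field_simps)
      then show ?thesis by (rule tendsto_eventually)
    next
      case False
      then have "real n - real k + 0 + 0 \<noteq> 0" using kn[OF k] by simp
      then have "((\<lambda>x. (real (j k) - real k + 1 / x) / (real n - real k + 1 / x + 1 / x))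
          \<longlongrightarrow> (real (j k) - real k + 0) / (real n - real k + 0 + 0)) at_top"
        by (intro tendsto_intros inverse_lim)
      then show ?thesis using False by (simp add: q_def)
    qed
    then have "(\<Sum>S\<in>alpha_tableaux n (j ` {1..l}). tableau_mass n \<alpha> \<beta> S) = (\<Prod>k=1..l. q k)"
      using mass_limit_diag_alpha[where f = "\<lambda>x. x" and g = "\<lambda>x. x", OF tableau_mass_limit_both _ mono range]
      by simp
    also have "\<dots> = (\<Prod>k=1..l. (real (j k) - real k + b) / (real n - real k + a + b))"
    \<comment> \<open>The factor for \<open>k = n\<close> occurs only if every column is prescribed; then \<open>j 1 = 1\<close>, and the
      factor for \<open>k = 1\<close>, which is a different one as \<open>n \<ge> 2\<close>, makes both products 0.\<close>
    proof (cases "l = n")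
      case True
      then have "j 1 + (n - 1) \<le> j n" "j n \<le> n" "1 \<le> j 1"
        using gap[of 1 n] j_bounds[of n] j_bounds[of 1] n by auto
      then have "j 1 = 1" using n by linarith
      then have "q 1 = 0" "(real (j 1) - real 1 + b) / (real n - real 1 + a + b) = 0"
        using n by (auto simp: q_def ab)
      then have "(\<Prod>k=1..l. q k) = 0"
        "(\<Prod>k=1..l. (real (j k) - real k + b) / (real n - real k + a + b)) = 0"
        using assms(7) by (auto intro!: prod_zero bexI[of _ 1])
      then show ?thesis by (simp only:)
    next
      case False
      then show ?thesis
        using kn[of l] assms(7) by (intro prod.cong) (auto simp: q_def ab)
    qed
    finally show ?thesis .
  qed (use assms in auto)
  then show ?thesis
    using prob_random_tableau[OF assms(1,2), of n "j ` {1..l}"] by simp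
qed

end
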